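(* Let $L$ be an MV-algebra and $a\in B(L)$. Then the MV-algebra $L$ is isomorphic to the direct product of the MV-algebras $(Fix_{d_a}(L),\oplus,\neg_1,0,a)$ and $(Fix_{d_{a^\ast}}(L),\oplus,\neg_2,0,a^\ast)$.
   Context: An MV-algebra is an algebra $(L,\oplus,{}^\ast,0)$ of type $(2,1,0)$ such that $(L,\oplus,0)$ is a commutative monoid, $(x^\ast)^\ast=x$, $0^\ast\oplus x=0^\ast$, and $(x^\ast\oplus y)^\ast\oplus y=(y^\ast\oplus x)^\ast\oplus x$ for all $x,y\in L$. Put $1=0^\ast$, $x\odot y=(x^\ast\oplus y^\ast)^\ast$, $x\ominus y=x\odot y^\ast$. The Boolean center is $B(L)=\{a\in L\mid a\oplus a=a\}$. For $a\in L$ define maps $L\to L$ by $d_a(x)=x\odot a$ and $d_{a^\ast}(x)=x\ominus a=x\odot a^\ast$. For a map $f:L\to L$, $Fix_f(L)=\{x\in L\mid f(x)=x\}$. For $a\in B(L)$: $(Fix_{d_a}(L),\oplus,\neg_1,0,a)$ is the MV-algebra with the addition $\oplus$ of $L$, negation $\neg_1x=d_a(x^\ast)$, zero element $0$ and unit (top) $a$; $(Fix_{d_{a^\ast}}(L),\oplus,\neg_2,0,a^\ast)$ is the MV-algebra with the addition $\oplus$ of $L$, negation $\neg_2x=d_{a^\ast}(x^\ast)$, zero element $0$ and unit (top) $a^\ast$. *)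

theory Defs
  imports "HOL-Algebra.Group"
begin

record 'a mv_struct = "'a partial_object" +
  oplus :: "'a \<Rightarrow> 'a \<Rightarrow> 'a"  (infixl "\<oplus>\<index>" 65)
  star :: "'a \<Rightarrow> 'a"  ("_\<^sup>\<star>\<index>" [1000] 999)
  zero :: 'a  ("\<zero>\<index>")

abbreviation oplus_monoid :: "('a, 'm) mv_struct_scheme \<Rightarrow> 'a monoid"
  where "oplus_monoid L \<equiv> \<lparr>carrier = carrier L, monoid.mult = oplus L, one = zero L\<rparr>"

locale mv_algebra =
  fixes L (structure)
  assumes oplus_comm_monoid: "comm_monoid (oplus_monoid L)"
    and star_closed: "x \<in> carrier L \<Longrightarrow> x\<^sup>\<star> \<in> carrier L"
    and star_star: "x \<in> carrier L \<Longrightarrow> (x\<^sup>\<star>)\<^sup>\<star> = x"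
    and star_zero_oplus: "x \<in> carrier L \<Longrightarrow> \<zero>\<^sup>\<star> \<oplus> x = \<zero>\<^sup>\<star>"
    and lukasiewicz: "\<lbrakk>x \<in> carrier L; y \<in> carrier L\<rbrakk> \<Longrightarrow>
          (x\<^sup>\<star> \<oplus> y)\<^sup>\<star> \<oplus> y = (y\<^sup>\<star> \<oplus> x)\<^sup>\<star> \<oplus> x"

(* The unit 1 is the derived constant 0*, so it is not a field of the record. *)
definition top_elem :: "('a, 'm) mv_struct_scheme \<Rightarrow> 'a"
  where "top_elem L = star L (zero L)"

definition odot :: "('a, 'm) mv_struct_scheme \<Rightarrow> 'a \<Rightarrow> 'a \<Rightarrow> 'a"  (infixl "\<odot>\<index>" 70)
  where "x \<odot>\<^bsub>L\<^esub> y = star L (oplus L (star L x) (star L y))"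

definition ominus :: "('a, 'm) mv_struct_scheme \<Rightarrow> 'a \<Rightarrow> 'a \<Rightarrow> 'a"  (infixl "\<ominus>\<index>" 65)
  where "x \<ominus>\<^bsub>L\<^esub> y = x \<odot>\<^bsub>L\<^esub> star L y"

definition boolean_center :: "('a, 'm) mv_struct_scheme \<Rightarrow> 'a set"
  where "boolean_center L = {a \<in> carrier L. a \<oplus>\<^bsub>L\<^esub> a = a}"

definition d :: "('a, 'm) mv_struct_scheme \<Rightarrow> 'a \<Rightarrow> 'a \<Rightarrow> 'a"
  where "d L a x = x \<odot>\<^bsub>L\<^esub> a"

(* The map written d_{a*} in the literature, x |-> x (-) a, is d taken at the element a*. *)
lemma d_star: "d L (star L a) x = x \<ominus>\<^bsub>L\<^esub> a"
  by (simp add: d_def ominus_def)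

definition Fix :: "('a, 'm) mv_struct_scheme \<Rightarrow> ('a \<Rightarrow> 'a) \<Rightarrow> 'a set"
  where "Fix L f = {x \<in> carrier L. f x = x}"

definition fix_algebra :: "('a, 'm) mv_struct_scheme \<Rightarrow> ('a \<Rightarrow> 'a) \<Rightarrow> 'a mv_struct"
  where "fix_algebra L f =
    \<lparr>carrier = Fix L f, oplus = oplus L, star = (\<lambda>x. f (star L x)), zero = zero L\<rparr>"

definition mv_prod ::
    "('a, 'm) mv_struct_scheme \<Rightarrow> ('b, 'n) mv_struct_scheme \<Rightarrow> ('a \<times> 'b) mv_struct"
  where "mv_prod L M =
    \<lparr>carrier = carrier L \<times> carrier M,
     oplus = (\<lambda>(x, y) (x', y'). (oplus L x x', oplus M y y')),
     star = (\<lambda>(x, y). (star L x, star M y)),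
     zero = (zero L, zero M)\<rparr>"

definition mv_hom ::
    "('a, 'm) mv_struct_scheme \<Rightarrow> ('b, 'n) mv_struct_scheme \<Rightarrow> ('a \<Rightarrow> 'b) set"
  where "mv_hom L M = {h \<in> carrier L \<rightarrow> carrier M.
    (\<forall>x\<in>carrier L. \<forall>y\<in>carrier L. h (x \<oplus>\<^bsub>L\<^esub> y) = h x \<oplus>\<^bsub>M\<^esub> h y) \<and>
    (\<forall>x\<in>carrier L. h (star L x) = star M (h x)) \<and>
    h (zero L) = zero M}"

definition mv_isomorphic ::
    "('a, 'm) mv_struct_scheme \<Rightarrow> ('b, 'n) mv_struct_scheme \<Rightarrow> bool"
  where "mv_isomorphic L M \<longleftrightarrow> (\<exists>h \<in> mv_hom L M. bij_betw h (carrier L) (carrier M))"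

end

(* For a in B(L) the maps d_a and d_{a*} are surjective MV-homomorphisms onto their fixed point
   sets, which are therefore MV-algebras as homomorphic images. The crucial point is that d_a is
   additive, which rests on the identity "v join b = v \<oplus> b" for Boolean b. Both maps together form
   a homomorphism into the product. It is onto because d_a kills the fixed points of d_{a*} and
   vice versa, and one-to-one because an element above both a and a* is the unit. *)
theory Submission imports Defs begin

lemma mv_homI:
  assumes "\<And>x. x \<in> carrier L \<Longrightarrow> h x \<in> carrier M"
    and "\<And>x y. x \<in> carrier L \<Longrightarrow> y \<in> carrier L \<Longrightarrow> h (x \<oplus>\<^bsub>L\<^esub> y) = h x \<oplus>\<^bsub>M\<^esub> h y"
    and "\<And>x. x \<in> carrier L \<Longrightarrow> h (star L x) = star M (h x)"
    and "h (zero L) = zero M"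
  shows "h \<in> mv_hom L M"
  using assms by (auto simp: mv_hom_def)

context mv_algebra
begin

text \<open>The natural order of an MV-algebra; \<open>\<zero>\<^sup>\<star>\<close> is the unit. As
  an abbreviation it stays an equation, so order facts serve directly as rewrite rules.\<close>

abbreviation le :: "'a \<Rightarrow> 'a \<Rightarrow> bool"  (infix "\<unlhd>" 50)
  where "x \<unlhd> y \<equiv> x\<^sup>\<star> \<oplus> y = \<zero>\<^sup>\<star>"

section \<open>Sums, the unit and the natural order\<close>

lemma zero_closed [simp]: "\<zero> \<in> carrier L"
  using comm_monoid.axioms(1)[OF oplus_comm_monoid] monoid.one_closed by fastforce

lemma oplus_closed [simp]: "x \<in> carrier L \<Longrightarrow> y \<in> carrier L \<Longrightarrow> x \<oplus> y \<in> carrier L"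
  using monoid.m_closed[OF comm_monoid.axioms(1)[OF oplus_comm_monoid]] by simp

lemma oplus_assoc:
  "x \<in> carrier L \<Longrightarrow> y \<in> carrier L \<Longrightarrow> z \<in> carrier L \<Longrightarrow> (x \<oplus> y) \<oplus> z = x \<oplus> (y \<oplus> z)"
  using monoid.m_assoc[OF comm_monoid.axioms(1)[OF oplus_comm_monoid]] by simp

lemma oplus_comm: "x \<in> carrier L \<Longrightarrow> y \<in> carrier L \<Longrightarrow> x \<oplus> y = y \<oplus> x"
  using comm_monoid.m_comm[OF oplus_comm_monoid] by simp

lemma oplus_left_comm:
  "x \<in> carrier L \<Longrightarrow> y \<in> carrier L \<Longrightarrow> z \<in> carrier L \<Longrightarrow> x \<oplus> (y \<oplus> z) = y \<oplus> (x \<oplus> z)"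
  using comm_monoid.m_lcomm[OF oplus_comm_monoid] by simp

lemmas oplus_ac = oplus_assoc oplus_comm oplus_left_comm

lemma zero_oplus [simp]: "x \<in> carrier L \<Longrightarrow> \<zero> \<oplus> x = x"
  using monoid.l_one[OF comm_monoid.axioms(1)[OF oplus_comm_monoid]] by simp

lemma oplus_zero [simp]: "x \<in> carrier L \<Longrightarrow> x \<oplus> \<zero> = x"
  by (simp add: oplus_comm[of x \<zero>])

declare star_closed [simp] star_star [simp] star_zero_oplus [simp]

lemma oplus_star_zero [simp]: "x \<in> carrier L \<Longrightarrow> x \<oplus> \<zero>\<^sup>\<star> = \<zero>\<^sup>\<star>"
  by (simp add: oplus_comm[of x "\<zero>\<^sup>\<star>"])

lemma le_refl [simp]: "x \<in> carrier L \<Longrightarrow> x \<unlhd> x"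
  \<comment> \<open>One side reduces to \<open>x\<^sup>\<star> \<oplus> x\<close>, the other to the
    unit.\<close>
  using lukasiewicz[of "\<zero>\<^sup>\<star>" x] by simp

lemma oplus_star_self [simp]: "x \<in> carrier L \<Longrightarrow> x \<oplus> x\<^sup>\<star> = \<zero>\<^sup>\<star>"
  using le_refl[of "x\<^sup>\<star>"] by simp

text \<open>Each inequality collapses one side of the Lukasiewicz axiom, to \<open>y\<close> and to
  \<open>x\<close> respectively.\<close>

lemma le_antisym: "x \<in> carrier L \<Longrightarrow> y \<in> carrier L \<Longrightarrow> x \<unlhd> y \<Longrightarrow> y \<unlhd> x \<Longrightarrow> x = y"
  using lukasiewicz[of x y] by simp

lemma le_oplus: "x \<in> carrier L \<Longrightarrow> y \<in> carrier L \<Longrightarrow> x \<unlhd> y \<oplus> x"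
  by (metis le_refl oplus_left_comm oplus_star_zero star_closed)

lemma le_iff_ex:
  assumes "x \<in> carrier L" "y \<in> carrier L"
  shows "x \<unlhd> y \<longleftrightarrow> (\<exists>c\<in>carrier L. y = c \<oplus> x)"
proof
  assume "x \<unlhd> y"
  \<comment> \<open>The witness \<open>(y\<^sup>\<star> \<oplus> x)\<^sup>\<star>\<close> is the
    difference \<open>y \<ominus> x\<close>.\<close>
  then have "y = (y\<^sup>\<star> \<oplus> x)\<^sup>\<star> \<oplus> x"
    using assms lukasiewicz[of x y] by simp
  then show "\<exists>c\<in>carrier L. y = c \<oplus> x"
    using assms by (metis oplus_closed star_closed)
qed (use assms in \<open>auto simp: le_oplus\<close>)

text \<open>By \<open>le_iff_ex\<close> each larger summand is the smaller one plus a remainder; the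
  two remainders add up to a remainder for the sum.\<close>

lemma oplus_mono:
  assumes "x \<in> carrier L" "y \<in> carrier L" "x' \<in> carrier L" "y' \<in> carrier L" "x \<unlhd> x'" "y \<unlhd> y'"
  shows "x \<oplus> y \<unlhd> x' \<oplus> y'"
proof -
  obtain c e where "c \<in> carrier L" "e \<in> carrier L" "x' = c \<oplus> x" "y' = e \<oplus> y"
    using assms le_iff_ex by metis
  then have "x' \<oplus> y' = (c \<oplus> e) \<oplus> (x \<oplus> y)" "c \<oplus> e \<in> carrier L"
    using assms(1,2) by (simp_all add: oplus_ac)
  then show ?thesis
    using assms(1,2) le_oplus by simp
qed

lemma star_antimono: "x \<in> carrier L \<Longrightarrow> y \<in> carrier L \<Longrightarrow> x \<unlhd> y \<Longrightarrow> y\<^sup>\<star> \<unlhd> x\<^sup>\<star>"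
  by (simp add: oplus_comm)

section \<open>The product and its residuation\<close>

lemma odot_closed [simp]: "x \<in> carrier L \<Longrightarrow> y \<in> carrier L \<Longrightarrow> x \<odot> y \<in> carrier L"
  by (simp add: odot_def)

lemma odot_assoc:
  "x \<in> carrier L \<Longrightarrow> y \<in> carrier L \<Longrightarrow> z \<in> carrier L \<Longrightarrow> (x \<odot> y) \<odot> z = x \<odot> (y \<odot> z)"
  by (simp add: odot_def oplus_assoc)

text \<open>Residuation: unfolded, both sides speak of the same sum up to associativity.\<close>

lemma odot_le_iff:
  "x \<in> carrier L \<Longrightarrow> y \<in> carrier L \<Longrightarrow> z \<in> carrier L \<Longrightarrow> x \<odot> y \<unlhd> z \<longleftrightarrow> x \<unlhd> y\<^sup>\<star> \<oplus> z"
  by (simp add: odot_def oplus_assoc)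

lemma odot_le1: "x \<in> carrier L \<Longrightarrow> y \<in> carrier L \<Longrightarrow> x \<odot> y \<unlhd> x"
  by (simp add: odot_le_iff le_oplus)

lemma odot_le2: "x \<in> carrier L \<Longrightarrow> y \<in> carrier L \<Longrightarrow> x \<odot> y \<unlhd> y"
  by (simp add: odot_le_iff)

lemma zero_odot [simp]: "x \<in> carrier L \<Longrightarrow> \<zero> \<odot> x = \<zero>"
  by (simp add: odot_def)

lemma odot_zero [simp]: "x \<in> carrier L \<Longrightarrow> x \<odot> \<zero> = \<zero>"
  by (simp add: odot_def)

lemma star_zero_odot [simp]: "x \<in> carrier L \<Longrightarrow> \<zero>\<^sup>\<star> \<odot> x = x"
  by (simp add: odot_def)

lemma odot_star_self [simp]: "x \<in> carrier L \<Longrightarrow> x \<odot> x\<^sup>\<star> = \<zero>"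
  by (simp add: odot_def)

lemma star_odot_self [simp]: "x \<in> carrier L \<Longrightarrow> x\<^sup>\<star> \<odot> x = \<zero>"
  by (simp add: odot_def)

section \<open>Boolean elements\<close>

lemma boolean_centerD:
  assumes "a \<in> boolean_center L"
  shows "a \<in> carrier L" "a \<oplus> a = a"
  using assms by (auto simp: boolean_center_def)

lemma star_boolean_center:
  assumes "a \<in> boolean_center L"
  shows "a\<^sup>\<star> \<in> boolean_center L"
proof -
  note a = boolean_centerD[OF assms]
  have "a\<^sup>\<star> \<oplus> a\<^sup>\<star> \<unlhd> a\<^sup>\<star>"
    \<comment> \<open>Since \<open>a \<oplus> a = a\<close>, one side of the axiom is
      \<open>a\<^sup>\<star> \<oplus> a\<close>, the unit; the other side unfolds the claimed
      inequality.\<close>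
    using lukasiewicz[of "a\<^sup>\<star>" a] a by simp
  then have "a\<^sup>\<star> \<oplus> a\<^sup>\<star> = a\<^sup>\<star>"
    using a(1) le_oplus[of "a\<^sup>\<star>" "a\<^sup>\<star>"] by - (rule le_antisym, simp_all)
  then show ?thesis
    using a(1) by (simp add: boolean_center_def)
qed

text \<open>The left-hand side is the lattice join of \<open>v\<close> and \<open>b\<close>.\<close>

lemma boolean_join:
  assumes "b \<in> boolean_center L" "v \<in> carrier L"
  shows "(v\<^sup>\<star> \<oplus> b)\<^sup>\<star> \<oplus> b = v \<oplus> b"
proof -
  note b = boolean_centerD[OF assms(1)]
  let ?j = "(v\<^sup>\<star> \<oplus> b)\<^sup>\<star> \<oplus> b"
  have j: "?j = (b\<^sup>\<star> \<oplus> v)\<^sup>\<star> \<oplus> v"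
    using assms(2) b(1) by (rule lukasiewicz)
  have "v \<unlhd> ?j"
    unfolding j using assms(2) b(1) by (simp add: le_oplus)
  then have "v \<oplus> b \<unlhd> ?j \<oplus> b"
    using assms(2) b(1) by (intro oplus_mono) simp_all
  \<comment> \<open>The join is a sum ending in \<open>b\<close>, so idempotency absorbs a further
    \<open>b\<close>.\<close>
  moreover have "?j \<oplus> b = ?j"
    using assms(2) b by (simp add: oplus_assoc)
  moreover have "?j \<unlhd> v \<oplus> b"
    using assms(2) b(1) by (intro oplus_mono) (simp_all add: oplus_ac)
  ultimately show ?thesis
    using assms(2) b(1) by - (rule le_antisym, simp_all)
qed

text \<open>Multiplying by a Boolean element is taking the meet. Dually,
  \<open>z\<^sup>\<star> \<oplus> a\<^sup>\<star>\<close> is a join by \<open>boolean_join\<close>,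
  and \<open>z \<unlhd> a\<close> makes this join equal to \<open>z\<^sup>\<star>\<close>.\<close>

lemma le_odot_boolean:
  assumes "a \<in> boolean_center L" "u \<in> carrier L" "z \<in> carrier L" "z \<unlhd> u" "z \<unlhd> a"
  shows "z \<unlhd> u \<odot> a"
proof -
  note a = boolean_centerD[OF assms(1)]
  have "z\<^sup>\<star> \<oplus> a\<^sup>\<star> = (z \<oplus> a\<^sup>\<star>)\<^sup>\<star> \<oplus> a\<^sup>\<star>"
    using boolean_join[OF star_boolean_center[OF assms(1)], of "z\<^sup>\<star>"] assms(3) by simp
  also have "\<dots> = (a \<oplus> z\<^sup>\<star>)\<^sup>\<star> \<oplus> z\<^sup>\<star>"
    using lukasiewicz[of "z\<^sup>\<star>" "a\<^sup>\<star>"] assms(3) a(1) by simp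
  also have "\<dots> = z\<^sup>\<star>"
    using assms(3,5) a(1) by (simp add: oplus_comm)
  finally have eq: "z\<^sup>\<star> \<oplus> a\<^sup>\<star> = z\<^sup>\<star>" .
  have "u\<^sup>\<star> \<oplus> a\<^sup>\<star> \<unlhd> z\<^sup>\<star> \<oplus> a\<^sup>\<star>"
    using assms(2-4) a(1) by (intro oplus_mono star_antimono) simp_all
  then show ?thesis
    using eq assms(2,3) a(1) by (simp add: odot_def oplus_comm)
qed

text \<open>Additivity of \<open>d L a\<close>. Residuation reduces one inequality to a bound on
  \<open>x \<oplus> y\<close>, where two copies of \<open>a\<^sup>\<star>\<close> merge into one.
  For the other, the meet property asks only for the bounds \<open>x \<oplus> y\<close> and
  \<open>a = a \<oplus> a\<close>.\<close>

lemma oplus_odot_distrib: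
  assumes "a \<in> boolean_center L" "x \<in> carrier L" "y \<in> carrier L"
  shows "(x \<oplus> y) \<odot> a = (x \<odot> a) \<oplus> (y \<odot> a)"
proof (rule le_antisym)
  note a = boolean_centerD[OF assms(1)]
  note b = boolean_centerD(2)[OF star_boolean_center[OF assms(1)]]
  \<comment> \<open>By residuation this is reflexivity of the order at
    \<open>v \<odot> a\<close>.\<close>
  have ge: "v \<unlhd> a\<^sup>\<star> \<oplus> (v \<odot> a)" if "v \<in> carrier L" for v
    using that a(1) by (simp flip: odot_le_iff)
  have "x \<oplus> y \<unlhd> (a\<^sup>\<star> \<oplus> (x \<odot> a)) \<oplus> (a\<^sup>\<star> \<oplus> (y \<odot> a))"
    using assms(2,3) a(1) by (intro oplus_mono ge) simp_all
  also have "(a\<^sup>\<star> \<oplus> (x \<odot> a)) \<oplus> (a\<^sup>\<star> \<oplus> (y \<odot> a)) = (a\<^sup>\<star> \<oplus> a\<^sup>\<star>) \<oplus> ((x \<odot> a) \<oplus> (y \<odot> a))"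
    using assms(2,3) a(1) by (simp add: oplus_ac)
  finally show "(x \<oplus> y) \<odot> a \<unlhd> (x \<odot> a) \<oplus> (y \<odot> a)"
    using assms(2,3) a(1) b by (simp add: odot_le_iff)
  have "(x \<odot> a) \<oplus> (y \<odot> a) \<unlhd> a \<oplus> a"
    using assms(2,3) a(1) by (intro oplus_mono odot_le2) simp_all
  moreover have "(x \<odot> a) \<oplus> (y \<odot> a) \<unlhd> x \<oplus> y"
    using assms(2,3) a(1) by (intro oplus_mono odot_le1) simp_all
  ultimately show "(x \<odot> a) \<oplus> (y \<odot> a) \<unlhd> (x \<oplus> y) \<odot> a"
    using assms a by (intro le_odot_boolean) simp_all
qed (use assms boolean_centerD(1) in simp_all)

lemma odot_boolean_idem:
  assumes "a \<in> boolean_center L" "x \<in> carrier L"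
  shows "(x \<odot> a) \<odot> a = x \<odot> a"
  using assms boolean_centerD(1) boolean_centerD(2)[OF star_boolean_center]
  by (simp add: odot_def oplus_assoc)

text \<open>Makes \<open>d L a\<close> respect negation: \<open>(x \<odot> a)\<^sup>\<star>\<close>
  is \<open>x\<^sup>\<star> \<oplus> a\<^sup>\<star>\<close>, and the additive map
  \<open>d L a\<close> kills \<open>a\<^sup>\<star>\<close>.\<close>

lemma star_odot_boolean:
  assumes "a \<in> boolean_center L" "x \<in> carrier L"
  shows "(x \<odot> a)\<^sup>\<star> \<odot> a = x\<^sup>\<star> \<odot> a"
proof -
  note a = boolean_centerD(1)[OF assms(1)]
  have "(x \<odot> a)\<^sup>\<star> \<odot> a = (x\<^sup>\<star> \<oplus> a\<^sup>\<star>) \<odot> a"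
    using assms(2) a by (simp add: odot_def[of L x a])
  also have "\<dots> = (x\<^sup>\<star> \<odot> a) \<oplus> (a\<^sup>\<star> \<odot> a)"
    using assms a by (simp add: oplus_odot_distrib)
  finally show ?thesis
    using assms(2) a by simp
qed

section \<open>Fixed point algebras as homomorphic images\<close>

lemma d_in_mv_hom:
  assumes "a \<in> boolean_center L"
  shows "d L a \<in> mv_hom L (fix_algebra L (d L a))"
  using assms boolean_centerD(1)[OF assms]
  by (intro mv_homI)
    (simp_all add: fix_algebra_def Fix_def d_def odot_boolean_idem oplus_odot_distrib
      star_odot_boolean)

text \<open>The axioms are equations and closure conditions, and every element of \<open>M\<close>
  is a value of \<open>h\<close>, so each one is carried over from \<open>L\<close> by
  \<open>h\<close>.\<close>

lemma mv_algebra_surj_image: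
  assumes h: "h \<in> mv_hom L M" and surj: "h ` carrier L = carrier M"
  shows "mv_algebra M"
proof -
  have plus: "h x \<oplus>\<^bsub>M\<^esub> h y = h (x \<oplus> y)" if "x \<in> carrier L" "y \<in> carrier L" for x y
    using h that by (simp add: mv_hom_def)
  have neg: "star M (h x) = h (x\<^sup>\<star>)" if "x \<in> carrier L" for x
    using h that by (simp add: mv_hom_def)
  have zero: "zero M = h \<zero>"
    using h by (simp add: mv_hom_def)
  show ?thesis
  proof (rule mv_algebra.intro)
    show "comm_monoid (oplus_monoid M)"
      by (rule comm_monoidI)
        (auto simp: surj[symmetric] plus zero oplus_assoc intro!: arg_cong[where f = h] oplus_comm)
  qed (auto simp: surj[symmetric] plus neg zero intro!: arg_cong[where f = h] lukasiewicz)
qed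

lemma mv_algebra_fix_algebra:
  assumes "a \<in> boolean_center L"
  shows "mv_algebra (fix_algebra L (d L a))"
proof (rule mv_algebra_surj_image[OF d_in_mv_hom[OF assms]])
  show "d L a ` carrier L = carrier (fix_algebra L (d L a))"
  proof
    show "d L a ` carrier L \<subseteq> carrier (fix_algebra L (d L a))"
      using d_in_mv_hom[OF assms] by (auto simp: mv_hom_def)
    \<comment> \<open>A fixed point is its own preimage.\<close>
    show "carrier (fix_algebra L (d L a)) \<subseteq> d L a ` carrier L"
      by (auto simp: fix_algebra_def Fix_def intro: rev_image_eqI[OF _ sym])
  qed
qed

lemma top_elem_fix_algebra:
  assumes "a \<in> carrier L"
  shows "top_elem (fix_algebra L (d L a)) = a"
  using assms by (simp add: top_elem_def fix_algebra_def d_def)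

section \<open>Decomposition into the two factors\<close>

lemma eq_star_zero_of_ge_boolean:
  assumes "a \<in> boolean_center L" "w \<in> carrier L" "a \<unlhd> w" "a\<^sup>\<star> \<unlhd> w"
  shows "w = \<zero>\<^sup>\<star>"
  \<comment> \<open>The join of \<open>w\<close> and \<open>a\<close> is \<open>w\<close> because
    \<open>a \<unlhd> w\<close>, and it is \<open>w \<oplus> a\<close> because \<open>a\<close> is
    Boolean; that sum is the unit because \<open>a\<^sup>\<star> \<unlhd> w\<close>.\<close>
  using lukasiewicz[of w a] boolean_join[OF assms(1,2)] boolean_centerD(1)[OF assms(1)] assms(2-4)
  by (simp add: oplus_comm)

text \<open>Yields injectivity when applied in both directions. The element
  \<open>x\<^sup>\<star> \<oplus> y\<close> lies above \<open>a\<close> and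
  \<open>a\<^sup>\<star>\<close>, hence is the unit.\<close>

lemma le_of_odot_boolean_eq:
  assumes "a \<in> boolean_center L" "x \<in> carrier L" "y \<in> carrier L"
    and "x \<odot> a = y \<odot> a" "x \<odot> a\<^sup>\<star> = y \<odot> a\<^sup>\<star>"
  shows "x \<unlhd> y"
proof (rule eq_star_zero_of_ge_boolean[OF assms(1)])
  have le: "c \<unlhd> x\<^sup>\<star> \<oplus> y" if c: "c \<in> boolean_center L" and eq: "x \<odot> c = y \<odot> c" for c
  proof -
    note cL = boolean_centerD(1)[OF c]
    \<comment> \<open>After distributing, \<open>y \<odot> c\<close> may be exchanged for
      \<open>x \<odot> c\<close>; the sum becomes the unit and the product becomes
      \<open>c\<close>.\<close>
    have "(x\<^sup>\<star> \<oplus> y) \<odot> c = (x\<^sup>\<star> \<oplus> x) \<odot> c"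
      using c assms(2,3) eq by (simp only: oplus_odot_distrib star_closed)
    then have "(x\<^sup>\<star> \<oplus> y) \<odot> c = c"
      using assms(2) cL by simp
    then show ?thesis
      using odot_le1[of "x\<^sup>\<star> \<oplus> y" c] assms(2,3) cL by simp
  qed
  show "a \<unlhd> x\<^sup>\<star> \<oplus> y" "a\<^sup>\<star> \<unlhd> x\<^sup>\<star> \<oplus> y"
    using le assms star_boolean_center by blast+
qed (use assms in simp)

lemma mv_isomorphic_fix_prod:
  assumes "a \<in> boolean_center L"
  shows "mv_isomorphic L (mv_prod (fix_algebra L (d L a)) (fix_algebra L (d L (a\<^sup>\<star>))))"
    (is "mv_isomorphic L ?P")
proof -
  let ?h = "\<lambda>x. (d L a x, d L (a\<^sup>\<star>) x)"
  note a = boolean_centerD(1)[OF assms]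
  note b = star_boolean_center[OF assms]
  have hom: "?h \<in> mv_hom L ?P"
    using d_in_mv_hom[OF assms] d_in_mv_hom[OF b]
    by (auto simp: mv_hom_def mv_prod_def)
  have "inj_on ?h (carrier L)"
  proof (rule inj_onI)
    fix x y
    assume xy: "x \<in> carrier L" "y \<in> carrier L" and "?h x = ?h y"
    then have "x \<odot> a = y \<odot> a" "x \<odot> a\<^sup>\<star> = y \<odot> a\<^sup>\<star>"
      by (simp_all add: d_def)
    then show "x = y"
      using xy le_of_odot_boolean_eq[OF assms] by - (rule le_antisym, metis+)
  qed
  moreover have "carrier ?P \<subseteq> ?h ` carrier L"
  proof
    fix p
    assume "p \<in> carrier ?P"
    then obtain u v where p: "p = (u, v)" and uv: "u \<in> carrier L" "v \<in> carrier L"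
      and fixed: "u \<odot> a = u" "v \<odot> a\<^sup>\<star> = v"
      by (auto simp: mv_prod_def fix_algebra_def Fix_def d_def)
    \<comment> \<open>Rewriting \<open>u\<close> as \<open>u \<odot> a\<close> and reassociating
      exposes the factor \<open>a \<odot> a\<^sup>\<star> = \<zero>\<close>; likewise for
      \<open>v\<close>. Hence \<open>u \<oplus> v\<close> is a preimage of
      \<open>(u, v)\<close>.\<close>
    have "u \<odot> a\<^sup>\<star> = \<zero>" "v \<odot> a = \<zero>"
      using odot_assoc[of u a "a\<^sup>\<star>"] odot_assoc[of v "a\<^sup>\<star>" a] uv fixed a by simp_all
    then have "?h (u \<oplus> v) = p"
      using oplus_odot_distrib[OF assms] oplus_odot_distrib[OF b] uv fixed
      by (simp add: d_def p)
    then show "p \<in> ?h ` carrier L"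
      using uv by (intro image_eqI[where x = "u \<oplus> v"]) auto
  qed
  moreover have "?h ` carrier L \<subseteq> carrier ?P"
    using hom by (auto simp: mv_hom_def)
  ultimately have "bij_betw ?h (carrier L) (carrier ?P)"
    by (auto simp: bij_betw_def)
  with hom show ?thesis
    unfolding mv_isomorphic_def by blast
qed

end

theorem theorem4p16:
  fixes L :: "('a, 'm) mv_struct_scheme" and a :: 'a
  assumes "mv_algebra L"
    and "a \<in> boolean_center L"
  shows "mv_algebra (fix_algebra L (d L a)) \<and>
    top_elem (fix_algebra L (d L a)) = a \<and>
    mv_algebra (fix_algebra L (d L (star L a))) \<and>
    top_elem (fix_algebra L (d L (star L a))) = star L a \<and>
    mv_isomorphic L (mv_prod (fix_algebra L (d L a)) (fix_algebra L (d L (star L a))))"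
proof -
  interpret mv_algebra L by fact
  show ?thesis
    using assms(2) star_boolean_center boolean_centerD(1)
    by (simp add: mv_algebra_fix_algebra top_elem_fix_algebra mv_isomorphic_fix_prod)
qed

end
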